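(* Let $v\ge1$, $n=2^v$, and let $\xi\in\mathbf{K}[\![v,1]\!]$ be a characteristic minmatrix with $\xi\ne\emptyset$. Then: (DR1) $\xi$ includes at least one of $\mathrm{Vv}_0$ or $\mathrm{Dd}_0$; (DR2) for $1\le k<n$, $\xi$ includes $\mathrm{Dw}_k$ only if it includes $\mathrm{Dd}_0$ and all $\mathrm{Dw}_l$ with $1\le l<k$; (DR3) for $1\le k<n$, $\xi$ includes $\mathrm{Dc}_k$ only if it includes $\mathrm{Dd}_0$, all $\mathrm{Dw}_l$ with $1\le l<k$, and all $\mathrm{Dc}_l$ with $1\le l<k$. (Here "includes" means inclusion as a subset of minterms.)
   Context: $m_0,\dots,m_{n-1}$ enumerate the $n=2^v$ Boolean minterms $\bigwedge_{k=0}^{v-1}\pm p_k$; $\Diamond^1m_i=\Diamond m_i$, $\Diamond^0m_i=\neg\Diamond m_i$. $\mathbf{K}[v,1]$ is the Lindenbaum–Tarski algebra (modulo provable equivalence in the least normal modal logic $\mathbf{K}$) of formulas in $p_0,\dots,p_{v-1}$ of modal degree $\le1$; its atoms (minterms) are the formulas $m_s\wedge\bigwedge_{i=0}^{n-1}\Diamond^{\varepsilon_i}m_i$ ($0\le s<n$, $\varepsilon\in\{0,1\}^n$), and each element $\varphi$ is identified with its set $[\varphi]$ of minterms. For a normal modal logic $\mathbf{S}$ (normal extension of $\mathbf{K}$), $[\![\mathbf{S}]\!]=\bigcap\{[\varphi]:\varphi\in\mathbf{K}[v,1],\ \mathbf{S}\vdash\varphi\}$, and $\mathbf{K}[\![v,1]\!]$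 is the set of all such characteristic minmatrices (the inconsistent logic gives $\emptyset$). The following sets of minterms (with $s$ ranging over $0,\dots,n-1$) are defined: $\mathrm{Vv}_0$: all $\varepsilon_i=0$; $\mathrm{Dd}_0$: $\varepsilon_s=1$, $\varepsilon_i=0$ for $i\ne s$; $\mathrm{Dc}_k$ ($1\le k<n$): $\varepsilon_s=0$ and exactly $k$ indices $i\ne s$ with $\varepsilon_i=1$; $\mathrm{Dw}_k$ ($1\le k<n$): $\varepsilon_s=1$ and exactly $k$ indices $i\ne s$ with $\varepsilon_i=1$. *)

theory Defs
  imports Main
begin

datatype fm = Bot | Var nat | Imp fm fm | Box fm

definition Neg :: "fm \<Rightarrow> fm" where "Neg \<phi> = Imp \<phi> Bot"
definition Top :: fm where "Top = Neg Bot"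
definition And :: "fm \<Rightarrow> fm \<Rightarrow> fm" where "And \<phi> \<psi> = Neg (Imp \<phi> (Neg \<psi>))"
definition Iff :: "fm \<Rightarrow> fm \<Rightarrow> fm" where "Iff \<phi> \<psi> = And (Imp \<phi> \<psi>) (Imp \<psi> \<phi>)"
definition Dia :: "fm \<Rightarrow> fm" where "Dia \<phi> = Neg (Box (Neg \<phi>))"
definition BigAnd :: "fm list \<Rightarrow> fm" where "BigAnd \<phi>s = foldr And \<phi>s Top"

fun vars :: "fm \<Rightarrow> nat set" where
  "vars Bot = {}"
| "vars (Var k) = {k}"
| "vars (Imp \<phi> \<psi>) = vars \<phi> \<union> vars \<psi>"
| "vars (Box \<phi>) = vars \<phi>"

fun mdeg :: "fm \<Rightarrow> nat" where
  "mdeg Bot = 0"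
| "mdeg (Var k) = 0"
| "mdeg (Imp \<phi> \<psi>) = max (mdeg \<phi>) (mdeg \<psi>)"
| "mdeg (Box \<phi>) = Suc (mdeg \<phi>)"

fun subst :: "(nat \<Rightarrow> fm) \<Rightarrow> fm \<Rightarrow> fm" where
  "subst \<sigma> Bot = Bot"
| "subst \<sigma> (Var k) = \<sigma> k"
| "subst \<sigma> (Imp \<phi> \<psi>) = Imp (subst \<sigma> \<phi>) (subst \<sigma> \<psi>)"
| "subst \<sigma> (Box \<phi>) = Box (subst \<sigma> \<phi>)"

text \<open>Propositional evaluation: variables and boxed formulas are both treated as
  propositional atoms, valued by \<open>V\<close> and \<open>W\<close> respectively.\<close>

fun peval :: "(nat \<Rightarrow> bool) \<Rightarrow> (fm \<Rightarrow> bool) \<Rightarrow> fm \<Rightarrow> bool" where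
  "peval V W Bot = False"
| "peval V W (Var k) = V k"
| "peval V W (Imp \<phi> \<psi>) = (peval V W \<phi> \<longrightarrow> peval V W \<psi>)"
| "peval V W (Box \<phi>) = W \<phi>"

definition tautology :: "fm \<Rightarrow> bool" where
  "tautology \<phi> \<longleftrightarrow> (\<forall>V W. peval V W \<phi>)"

definition normal_logic :: "fm set \<Rightarrow> bool" where
  "normal_logic S \<longleftrightarrow>
     (\<forall>\<phi>. tautology \<phi> \<longrightarrow> \<phi> \<in> S) \<and>
     (\<forall>\<phi> \<psi>. Imp (Box (Imp \<phi> \<psi>)) (Imp (Box \<phi>) (Box \<psi>)) \<in> S) \<and>
     (\<forall>\<phi> \<psi>. Imp \<phi> \<psi> \<in> S \<longrightarrow> \<phi> \<in> S \<longrightarrow> \<psi> \<in> S) \<and>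
     (\<forall>\<phi>. \<phi> \<in> S \<longrightarrow> Box \<phi> \<in> S) \<and>
     (\<forall>\<phi> \<sigma>. \<phi> \<in> S \<longrightarrow> subst \<sigma> \<phi> \<in> S)"

definition K :: "fm set" where
  "K = \<Inter> {S. normal_logic S}"

definition Fm :: "nat \<Rightarrow> nat \<Rightarrow> fm set" where
  "Fm v d = {\<phi>. vars \<phi> \<subseteq> {..<v} \<and> mdeg \<phi> \<le> d}"

definition K_equiv :: "nat \<Rightarrow> nat \<Rightarrow> (fm \<times> fm) set" where
  "K_equiv v d = {(\<phi>, \<psi>). \<phi> \<in> Fm v d \<and> \<psi> \<in> Fm v d \<and> Iff \<phi> \<psi> \<in> K}"

text \<open>Lindenbaum--Tarski algebra (carrier), its order, and provability of
  its elements in a normal logic; the last two do not depend on the representatives.\<close>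

definition K_alg :: "nat \<Rightarrow> nat \<Rightarrow> fm set set" where
  "K_alg v d = Fm v d // K_equiv v d"

definition alg_le :: "fm set \<Rightarrow> fm set \<Rightarrow> bool" where
  "alg_le a b \<longleftrightarrow> (\<exists>\<phi>\<in>a. \<exists>\<psi>\<in>b. Imp \<phi> \<psi> \<in> K)"

definition provable :: "fm set \<Rightarrow> fm set \<Rightarrow> bool" where
  "provable S a \<longleftrightarrow> (\<exists>\<phi>\<in>a. \<phi> \<in> S)"

text \<open>The Boolean minterms are enumerated by binary expansion of the index: \<open>p\<^sub>k\<close> occurs
  positively in the \<open>i\<close>-th one iff the \<open>k\<close>-th binary digit of \<open>i\<close> is 1 (for \<open>i < 2 ^ v\<close>).\<close>

definition bool_minterm :: "nat \<Rightarrow> nat \<Rightarrow> fm" where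
  "bool_minterm v i = BigAnd (map (\<lambda>k. if bit i k then Var k else Neg (Var k)) [0..<v])"

definition minterm_fm :: "nat \<Rightarrow> nat \<Rightarrow> (nat \<Rightarrow> bool) \<Rightarrow> fm" where
  "minterm_fm v s \<epsilon> =
     And (bool_minterm v s)
         (BigAnd (map (\<lambda>i. if \<epsilon> i then Dia (bool_minterm v i) else Neg (Dia (bool_minterm v i)))
                      [0..<2 ^ v]))"

text \<open>Only the values \<open>\<epsilon> i\<close> with \<open>i < 2 ^ v\<close> matter in the following.\<close>

definition minterm :: "nat \<Rightarrow> nat \<Rightarrow> (nat \<Rightarrow> bool) \<Rightarrow> fm set" where
  "minterm v s \<epsilon> = K_equiv v 1 `` {minterm_fm v s \<epsilon>}"

definition minterms :: "nat \<Rightarrow> fm set set" where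
  "minterms v = {minterm v s \<epsilon> | s \<epsilon>. s < 2 ^ v}"

definition minset :: "nat \<Rightarrow> fm set \<Rightarrow> fm set set" where
  "minset v a = {m \<in> minterms v. alg_le m a}"

definition char_minmatrix :: "nat \<Rightarrow> fm set \<Rightarrow> fm set set" where
  "char_minmatrix v S = \<Inter> {minset v a | a. a \<in> K_alg v 1 \<and> provable S a}"

definition char_minmatrices :: "nat \<Rightarrow> fm set set set" where
  "char_minmatrices v = {char_minmatrix v S | S. normal_logic S}"

definition Vv0 :: "nat \<Rightarrow> fm set set" where
  "Vv0 v = {minterm v s \<epsilon> | s \<epsilon>. s < 2 ^ v \<and> (\<forall>i<2 ^ v. \<not> \<epsilon> i)}"

definition Dd0 :: "nat \<Rightarrow> fm set set" where
  "Dd0 v = {minterm v s \<epsilon> | s \<epsilon>. s < 2 ^ v \<and> \<epsilon> s \<and> (\<forall>i<2 ^ v. i \<noteq> s \<longrightarrow> \<not> \<epsilon> i)}"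

definition Dc :: "nat \<Rightarrow> nat \<Rightarrow> fm set set" where
  "Dc v k = {minterm v s \<epsilon> | s \<epsilon>. s < 2 ^ v \<and> \<not> \<epsilon> s \<and> card {i. i < 2 ^ v \<and> i \<noteq> s \<and> \<epsilon> i} = k}"

definition Dw :: "nat \<Rightarrow> nat \<Rightarrow> fm set set" where
  "Dw v k = {minterm v s \<epsilon> | s \<epsilon>. s < 2 ^ v \<and> \<epsilon> s \<and> card {i. i < 2 ^ v \<and> i \<noteq> s \<and> \<epsilon> i} = k}"

end

theory Submission
  imports Defs "HOL-Combinatorics.Transposition"
begin

text \<open>A minterm \<open>(s, \<epsilon>)\<close> describes a pointed Kripke model up to depth one: the root has valuation
  \<open>s\<close>, and the valuations of its successors are exactly those in \<open>E = {i. \<epsilon> i}\<close>. Modulo \<open>K\<close> it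
  decides every formula of degree at most one, so it lies in the characteristic minmatrix of \<open>S\<close> iff
  all theorems of \<open>S\<close> in \<open>v\<close> variables and of degree at most one hold at the root of one (equivalently,
  every) model of it. Every map \<open>f\<close> on valuations is induced by a substitution of Boolean
  formulas; since \<open>S\<close> is closed under substitution, membership passes from \<open>(s', E')\<close> to
  \<open>(f s', f ` E')\<close>. Hence it passes to every \<open>(s, E)\<close> with \<open>card E \<le> card E'\<close>, provided that
  \<open>E\<close> and \<open>E'\<close> are both empty or both nonempty and that \<open>s' \<in> E'\<close> implies \<open>s \<in> E\<close>. All three rules
  are instances of this.\<close>

section \<open>Kripke semantics\<close>

fun holds :: "('w \<Rightarrow> 'w \<Rightarrow> bool) \<Rightarrow> ('w \<Rightarrow> nat \<Rightarrow> bool) \<Rightarrow> 'w \<Rightarrow> fm \<Rightarrow> bool" where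
  "holds R V w Bot = False"
| "holds R V w (Var k) = V w k"
| "holds R V w (Imp \<phi> \<psi>) = (holds R V w \<phi> \<longrightarrow> holds R V w \<psi>)"
| "holds R V w (Box \<phi>) = (\<forall>u. R w u \<longrightarrow> holds R V u \<phi>)"

lemma holds_Neg [simp]: "holds R V w (Neg \<phi>) \<longleftrightarrow> \<not> holds R V w \<phi>"
  by (simp add: Neg_def)

lemma holds_BigAnd [simp]: "holds R V w (BigAnd \<phi>s) \<longleftrightarrow> (\<forall>\<phi>\<in>set \<phi>s. holds R V w \<phi>)"
  by (induction \<phi>s) (simp_all add: BigAnd_def And_def Top_def)

lemma peval_derived_connectives [simp]:
  "peval V W Top"
  "peval V W (Neg \<phi>) \<longleftrightarrow> \<not> peval V W \<phi>"
  "peval V W (And \<phi> \<psi>) \<longleftrightarrow> peval V W \<phi> \<and> peval V W \<psi>"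
  "peval V W (Iff \<phi> \<psi>) \<longleftrightarrow> (peval V W \<phi> \<longleftrightarrow> peval V W \<psi>)"
  "peval V W (Dia \<phi>) \<longleftrightarrow> \<not> W (Neg \<phi>)"
  by (auto simp: Neg_def Top_def And_def Iff_def Dia_def)

lemma peval_BigAnd [simp]: "peval V W (BigAnd \<phi>s) \<longleftrightarrow> (\<forall>\<phi>\<in>set \<phi>s. peval V W \<phi>)"
  by (induction \<phi>s) (simp_all add: BigAnd_def)

lemma peval_foldr_Imp [simp]:
  "peval V W (foldr Imp \<phi>s \<psi>) \<longleftrightarrow> ((\<forall>\<phi>\<in>set \<phi>s. peval V W \<phi>) \<longrightarrow> peval V W \<psi>)"
  by (induction \<phi>s) auto

lemma holds_eq_peval:
  "holds R V w \<phi> = peval (V w) (\<lambda>\<psi>. holds R V w (Box \<psi>)) \<phi>"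
  by (induction \<phi>) auto

lemma holds_subst:
  "holds R V w (subst \<sigma> \<phi>) = holds R (\<lambda>u k. holds R V u (\<sigma> k)) w \<phi>"
  by (induction \<phi> arbitrary: w) auto

lemma peval_cong_if_mdeg_0:
  assumes "mdeg \<phi> = 0" "\<And>k. k \<in> vars \<phi> \<Longrightarrow> V k = V' k"
  shows "peval V W \<phi> = peval V' W' \<phi>"
  using assms by (induction \<phi>) auto

lemma normal_logic_of_frame: "normal_logic {\<phi>. \<forall>V w. holds R V w \<phi>}"
proof -
  have "holds R V w \<phi>" if "tautology \<phi>" for V w \<phi>
    using that unfolding tautology_def by (subst holds_eq_peval) blast
  then show ?thesis
    unfolding normal_logic_def by (auto simp: holds_subst)
qed

lemma K_sound: "\<phi> \<in> K \<Longrightarrow> holds R V w \<phi>"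
  using normal_logic_of_frame[of R] unfolding K_def by blast

section \<open>Derivations in normal logics\<close>

lemma normal_logic_K: "normal_logic K"
  unfolding K_def normal_logic_def by blast

lemma K_subset_normal_logic: "normal_logic S \<Longrightarrow> K \<subseteq> S"
  unfolding K_def by blast

lemma normal_logic_tautology: "normal_logic S \<Longrightarrow> tautology \<phi> \<Longrightarrow> \<phi> \<in> S"
  unfolding normal_logic_def by blast

lemma normal_logic_mp: "normal_logic S \<Longrightarrow> Imp \<phi> \<psi> \<in> S \<Longrightarrow> \<phi> \<in> S \<Longrightarrow> \<psi> \<in> S"
  unfolding normal_logic_def by blast

lemma normal_logic_foldr_mp:
  assumes "normal_logic S" "foldr Imp \<phi>s \<psi> \<in> S" "set \<phi>s \<subseteq> S"
  shows "\<psi> \<in> S"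
  using assms(2,3) by (induction \<phi>s) (auto dest: normal_logic_mp[OF assms(1)])

lemma normal_logic_taut_conseq:
  assumes "normal_logic S" "set \<phi>s \<subseteq> S"
    and "\<And>V W. \<forall>\<phi>\<in>set \<phi>s. peval V W \<phi> \<Longrightarrow> peval V W \<psi>"
  shows "\<psi> \<in> S"
proof -
  have "tautology (foldr Imp \<phi>s \<psi>)"
    using assms(3) by (auto simp: tautology_def)
  then show ?thesis
    using assms(1,2) normal_logic_tautology normal_logic_foldr_mp by blast
qed

lemma normal_logic_K_axiom_foldr:
  assumes "normal_logic S"
  shows "Imp (Box (foldr Imp \<phi>s \<psi>)) (foldr Imp (map Box \<phi>s) (Box \<psi>)) \<in> S"
proof (induction \<phi>s)
  case Nil
  show ?case
    using assms by (intro normal_logic_tautology) (auto simp: tautology_def)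
next
  case (Cons \<phi> \<phi>s)
  let ?\<chi> = "foldr Imp \<phi>s \<psi>"
  let ?K = "Imp (Box (Imp \<phi> ?\<chi>)) (Imp (Box \<phi>) (Box ?\<chi>))"
  let ?IH = "Imp (Box ?\<chi>) (foldr Imp (map Box \<phi>s) (Box \<psi>))"
  have "?K \<in> S"
    using assms unfolding normal_logic_def by blast
  with Cons show ?case
    by (intro normal_logic_taut_conseq[OF assms, of "[?K, ?IH]"]) auto
qed

lemma normal_logic_Box_foldr_Imp:
  assumes "normal_logic S" "foldr Imp \<phi>s \<psi> \<in> S"
  shows "foldr Imp (map Box \<phi>s) (Box \<psi>) \<in> S"
proof -
  have "Box (foldr Imp \<phi>s \<psi>) \<in> S"
    using assms unfolding normal_logic_def by blast
  then show ?thesis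
    using normal_logic_mp normal_logic_K_axiom_foldr assms(1) by blast
qed

definition K_decides :: "fm \<Rightarrow> fm \<Rightarrow> bool" where
  "K_decides \<mu> \<phi> \<longleftrightarrow> Imp \<mu> \<phi> \<in> K \<or> Imp \<mu> (Neg \<phi>) \<in> K"

lemma K_decides_if_tautology:
  assumes "tautology (Imp \<mu> \<phi>) \<or> tautology (Imp \<mu> (Neg \<phi>))"
  shows "K_decides \<mu> \<phi>"
  using assms normal_logic_tautology[OF normal_logic_K] unfolding K_decides_def by blast

lemma K_decides_Imp:
  assumes "K_decides \<mu> \<phi>" "K_decides \<mu> \<psi>"
  shows "K_decides \<mu> (Imp \<phi> \<psi>)"
proof -
  note conseq = normal_logic_taut_conseq[OF normal_logic_K]
  consider (premise_refuted) "Imp \<mu> (Neg \<phi>) \<in> K" | (conclusion_proved) "Imp \<mu> \<psi> \<in> K"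
    | (counterexample) "Imp \<mu> \<phi> \<in> K" "Imp \<mu> (Neg \<psi>) \<in> K"
    using assms unfolding K_decides_def by blast
  then show ?thesis
  proof cases
    case premise_refuted
    then have "Imp \<mu> (Imp \<phi> \<psi>) \<in> K"
      by (intro conseq[of "[Imp \<mu> (Neg \<phi>)]"]) auto
    then show ?thesis unfolding K_decides_def ..
  next
    case conclusion_proved
    then have "Imp \<mu> (Imp \<phi> \<psi>) \<in> K"
      by (intro conseq[of "[Imp \<mu> \<psi>]"]) auto
    then show ?thesis unfolding K_decides_def ..
  next
    case counterexample
    then have "Imp \<mu> (Neg (Imp \<phi> \<psi>)) \<in> K"
      by (intro conseq[of "[Imp \<mu> \<phi>, Imp \<mu> (Neg \<psi>)]"]) auto
    then show ?thesis unfolding K_decides_def ..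
  qed
qed

lemma K_decided_imp_iff_holds:
  assumes "K_decides \<mu> \<phi>" "holds R V w \<mu>"
  shows "Imp \<mu> \<phi> \<in> K \<longleftrightarrow> holds R V w \<phi>"
proof -
  have "holds R V w \<phi>" if "Imp \<mu> \<phi> \<in> K"
    using K_sound[OF that, of R V w] assms(2) by simp
  moreover have "\<not> holds R V w \<phi>" if "Imp \<mu> (Neg \<phi>) \<in> K"
    using K_sound[OF that, of R V w] assms(2) by simp
  ultimately show ?thesis
    using assms(1) unfolding K_decides_def by blast
qed

section \<open>Variables and modal degree\<close>

lemma vars_derived_connectives [simp]:
  "vars (Neg \<phi>) = vars \<phi>"
  "vars (And \<phi> \<psi>) = vars \<phi> \<union> vars \<psi>"
  "vars (Dia \<phi>) = vars \<phi>"
  by (simp_all add: Neg_def And_def Dia_def)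

lemma mdeg_derived_connectives [simp]:
  "mdeg (Neg \<phi>) = mdeg \<phi>"
  "mdeg (And \<phi> \<psi>) = max (mdeg \<phi>) (mdeg \<psi>)"
  "mdeg (Dia \<phi>) = Suc (mdeg \<phi>)"
  by (simp_all add: Neg_def And_def Dia_def)

lemma Fm_simps [simp]:
  "Top \<in> Fm v d"
  "Var k \<in> Fm v d \<longleftrightarrow> k < v"
  "Neg \<phi> \<in> Fm v d \<longleftrightarrow> \<phi> \<in> Fm v d"
  "And \<phi> \<psi> \<in> Fm v d \<longleftrightarrow> \<phi> \<in> Fm v d \<and> \<psi> \<in> Fm v d"
  "Imp \<phi> \<psi> \<in> Fm v d \<longleftrightarrow> \<phi> \<in> Fm v d \<and> \<psi> \<in> Fm v d"
  "Dia \<phi> \<in> Fm v (Suc d) \<longleftrightarrow> \<phi> \<in> Fm v d"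
  "Box \<phi> \<in> Fm v (Suc d) \<longleftrightarrow> \<phi> \<in> Fm v d"
  by (auto simp: Fm_def Top_def)

lemma BigAnd_in_Fm [simp]: "BigAnd \<phi>s \<in> Fm v d \<longleftrightarrow> set \<phi>s \<subseteq> Fm v d"
  by (induction \<phi>s) (simp_all add: BigAnd_def)

lemma vars_subst: "vars (subst \<sigma> \<phi>) = (\<Union>k\<in>vars \<phi>. vars (\<sigma> k))"
  by (induction \<phi>) auto

lemma mdeg_subst_le:
  assumes "\<And>k. k \<in> vars \<phi> \<Longrightarrow> mdeg (\<sigma> k) \<le> e"
  shows "mdeg (subst \<sigma> \<phi>) \<le> mdeg \<phi> + e"
  using assms by (induction \<phi>) fastforce+

lemma subst_in_Fm:
  assumes "\<phi> \<in> Fm v d" "\<And>k. k < v \<Longrightarrow> \<sigma> k \<in> Fm v' e"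
  shows "subst \<sigma> \<phi> \<in> Fm v' (d + e)"
proof -
  have "mdeg (subst \<sigma> \<phi>) \<le> mdeg \<phi> + e"
    using assms by (intro mdeg_subst_le) (auto simp: Fm_def)
  then show ?thesis
    using assms by (fastforce simp: Fm_def vars_subst)
qed

section \<open>Boolean minterms\<close>

definition valuation_index :: "nat \<Rightarrow> (nat \<Rightarrow> bool) \<Rightarrow> nat" where
  "valuation_index v U = horner_sum of_bool 2 (map U [0..<v])"

lemma valuation_index_less: "valuation_index v U < 2 ^ v"
  using horner_sum_of_bool_2_less[of "map U [0..<v]"] by (simp add: valuation_index_def)

lemma bit_valuation_index: "k < v \<Longrightarrow> bit (valuation_index v U) k = U k"
  by (simp add: valuation_index_def bit_horner_sum_bit_iff)

lemma valuation_index_bit: "valuation_index v (bit i) = take_bit v i"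
  by (simp add: valuation_index_def horner_sum_bit_eq_take_bit)

lemma valuation_index_eq_iff:
  assumes "i < 2 ^ v"
  shows "valuation_index v U = i \<longleftrightarrow> (\<forall>k<v. U k = bit i k)"
proof
  show "valuation_index v U = i \<Longrightarrow> \<forall>k<v. U k = bit i k"
    using bit_valuation_index by blast
next
  assume "\<forall>k<v. U k = bit i k"
  then have "valuation_index v U = valuation_index v (bit i)"
    unfolding valuation_index_def by (intro arg_cong[where f = "horner_sum _ _"]) simp
  also have "\<dots> = i"
    using assms by (simp add: valuation_index_bit take_bit_nat_eq_self)
  finally show "valuation_index v U = i" .
qed

lemma peval_bool_minterm [simp]:
  assumes "i < 2 ^ v"
  shows "peval U W (bool_minterm v i) \<longleftrightarrow> valuation_index v U = i"
  using assms by (auto simp: bool_minterm_def valuation_index_eq_iff simp del: if_image_distrib)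

lemma holds_bool_minterm [simp]:
  assumes "i < 2 ^ v"
  shows "holds R V w (bool_minterm v i) \<longleftrightarrow> valuation_index v (V w) = i"
  using assms by (simp add: holds_eq_peval[of _ _ _ "bool_minterm v i"])

lemma bool_minterm_in_Fm [simp]: "bool_minterm v i \<in> Fm v d"
  by (auto simp: bool_minterm_def)

lemma bool_minterm_decides_tautologically:
  assumes "i < 2 ^ v" "\<phi> \<in> Fm v 0"
  shows "tautology (Imp (bool_minterm v i) \<phi>) \<or> tautology (Imp (bool_minterm v i) (Neg \<phi>))"
proof -
  have "peval U W \<phi> = peval (bit i) (\<lambda>_. False) \<phi>" if "valuation_index v U = i" for U W
    using that assms by (intro peval_cong_if_mdeg_0) (auto simp: Fm_def valuation_index_eq_iff)
  then show ?thesis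
    using assms(1) by (auto simp: tautology_def)
qed

lemma tautology_foldr_Imp_Neg_bool_minterms:
  assumes "\<And>i. i < 2 ^ v \<Longrightarrow> P i \<Longrightarrow> tautology (Imp (bool_minterm v i) \<phi>)"
  shows "tautology (foldr Imp
    (map (\<lambda>i. Neg (bool_minterm v i)) (filter (\<lambda>i. \<not> P i) [0..<2 ^ v])) \<phi>)"
    (is "tautology (foldr Imp ?\<psi>s \<phi>)")
proof -
  have "peval U W (foldr Imp ?\<psi>s \<phi>)" for U W
  proof (cases "P (valuation_index v U)")
    case True
    then have "peval U W \<phi>"
      using assms[OF valuation_index_less] by (simp add: tautology_def valuation_index_less)
    then show ?thesis by simp
  qed (use valuation_index_less in auto)
  then show ?thesis
    unfolding tautology_def by blast
qed

text \<open>The disjunctive normal form of \<open>p\<^sub>k\<close> composed with \<open>f\<close>, rewritten by De Morgan's law.\<close>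

definition map_subst :: "nat \<Rightarrow> (nat \<Rightarrow> nat) \<Rightarrow> nat \<Rightarrow> fm" where
  "map_subst v f k =
     Neg (BigAnd (map (\<lambda>i. Neg (bool_minterm v i)) (filter (\<lambda>i. bit (f i) k) [0..<2 ^ v])))"

lemma map_subst_in_Fm: "map_subst v f k \<in> Fm v d"
  by (auto simp: map_subst_def)

lemma holds_map_subst:
  "holds R V w (map_subst v f k) \<longleftrightarrow> bit (f (valuation_index v (V w))) k"
  using valuation_index_less by (auto simp: map_subst_def)

section \<open>Models of minterms\<close>

definition successors :: "nat \<Rightarrow> (nat \<Rightarrow> bool) \<Rightarrow> nat set" where
  "successors v \<epsilon> = {i. i < 2 ^ v \<and> \<epsilon> i}"

lemma mem_successors_iff: "s < 2 ^ v \<Longrightarrow> s \<in> successors v \<epsilon> \<longleftrightarrow> \<epsilon> s"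
  by (simp add: successors_def)

lemma finite_successors: "finite (successors v \<epsilon>)"
  by (simp add: successors_def)

lemma take_bit_image_successors: "take_bit v ` successors v \<epsilon> = successors v \<epsilon>"
  by (force simp: successors_def take_bit_nat_eq_self)

lemma minterm_fm_in_Fm: "minterm_fm v s \<epsilon> \<in> Fm v 1"
  by (auto simp: minterm_fm_def)

lemma peval_minterm_fm:
  assumes "s < 2 ^ v"
  shows "peval U W (minterm_fm v s \<epsilon>) \<longleftrightarrow>
    valuation_index v U = s \<and> (\<forall>i<2 ^ v. \<epsilon> i \<longleftrightarrow> \<not> W (Neg (bool_minterm v i)))"
  using assms by (auto simp: minterm_fm_def simp del: if_image_distrib split: if_splits)

lemma holds_minterm_fm_iff:
  assumes "s < 2 ^ v"
  shows "holds R V w (minterm_fm v s \<epsilon>) \<longleftrightarrow>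
    valuation_index v (V w) = s \<and> (\<lambda>u. valuation_index v (V u)) ` {u. R w u} = successors v \<epsilon>"
proof -
  let ?E = "(\<lambda>u. valuation_index v (V u)) ` {u. R w u}"
  have "holds R V w (minterm_fm v s \<epsilon>) \<longleftrightarrow>
      valuation_index v (V w) = s \<and> (\<forall>i<2 ^ v. \<epsilon> i \<longleftrightarrow> i \<in> ?E)"
    using assms by (subst holds_eq_peval) (auto simp: peval_minterm_fm)
  moreover have "(\<forall>i<2 ^ v. \<epsilon> i \<longleftrightarrow> i \<in> ?E) \<longleftrightarrow> ?E = successors v \<epsilon>"
    using valuation_index_less by (auto simp: successors_def)
  ultimately show ?thesis by simp
qed

lemma minterm_fm_satisfiable:
  assumes "s < 2 ^ v"
  obtains R V and w :: "nat option" where "holds R V w (minterm_fm v s \<epsilon>)"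
proof
  let ?R = "\<lambda>w u. w = None \<and> u \<in> Some ` successors v \<epsilon>"
  let ?V = "\<lambda>w. bit (case w of None \<Rightarrow> s | Some i \<Rightarrow> i)"
  show "holds ?R ?V None (minterm_fm v s \<epsilon>)"
    using assms
    by (simp add: holds_minterm_fm_iff valuation_index_bit take_bit_nat_eq_self image_image
        take_bit_image_successors)
qed

lemma minterm_fm_decides_Box:
  assumes s: "s < 2 ^ v" and \<phi>: "\<phi> \<in> Fm v 0"
  shows "K_decides (minterm_fm v s \<epsilon>) (Box \<phi>)"
proof (cases "\<exists>i\<in>successors v \<epsilon>. tautology (Imp (bool_minterm v i) (Neg \<phi>))")
  case True
  then obtain i where i: "i < 2 ^ v" "\<epsilon> i" "tautology (Imp (bool_minterm v i) (Neg \<phi>))"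
    by (auto simp: successors_def)
  let ?\<psi> = "Neg (bool_minterm v i)"
  have "foldr Imp [\<phi>] ?\<psi> \<in> K"
    using i(3) by (intro normal_logic_tautology[OF normal_logic_K]) (auto simp: tautology_def)
  then have "Imp (Box \<phi>) (Box ?\<psi>) \<in> K"
    using normal_logic_Box_foldr_Imp[OF normal_logic_K, of "[\<phi>]"] by simp
  then have "Imp (minterm_fm v s \<epsilon>) (Neg (Box \<phi>)) \<in> K"
    using s i(1,2)
    by (intro normal_logic_taut_conseq[OF normal_logic_K, of "[Imp (Box \<phi>) (Box ?\<psi>)]"])
      (auto simp: peval_minterm_fm)
  then show ?thesis unfolding K_decides_def ..
next
  case False
  let ?\<psi>s = "map (\<lambda>i. Neg (bool_minterm v i)) (filter (\<lambda>i. \<not> \<epsilon> i) [0..<2 ^ v])"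
  have "tautology (Imp (bool_minterm v i) \<phi>)" if "i < 2 ^ v" "\<epsilon> i" for i
    using False bool_minterm_decides_tautologically[OF that(1) \<phi>] that
    by (auto simp: mem_successors_iff)
  then have "foldr Imp ?\<psi>s \<phi> \<in> K"
    by (intro normal_logic_tautology[OF normal_logic_K] tautology_foldr_Imp_Neg_bool_minterms)
  then have "foldr Imp (map Box ?\<psi>s) (Box \<phi>) \<in> K"
    by (rule normal_logic_Box_foldr_Imp[OF normal_logic_K])
  then have "Imp (minterm_fm v s \<epsilon>) (Box \<phi>) \<in> K"
    using s
    by (intro normal_logic_taut_conseq[OF normal_logic_K,
          of "[foldr Imp (map Box ?\<psi>s) (Box \<phi>)]"])
      (auto simp: peval_minterm_fm)
  then show ?thesis unfolding K_decides_def ..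
qed

lemma minterm_fm_decides:
  assumes "s < 2 ^ v" "\<phi> \<in> Fm v 1"
  shows "K_decides (minterm_fm v s \<epsilon>) \<phi>"
  using assms(2)
proof (induction \<phi>)
  case Bot
  show ?case
    by (rule K_decides_if_tautology) (simp add: tautology_def)
next
  case (Var k)
  then have "peval U W (Var k) = bit s k" if "peval U W (minterm_fm v s \<epsilon>)" for U W
    using that assms(1) by (auto simp: peval_minterm_fm bit_valuation_index)
  then show ?case
    by (intro K_decides_if_tautology) (auto simp: tautology_def)
next
  case (Imp \<phi> \<psi>)
  then show ?case by (simp add: K_decides_Imp)
next
  case (Box \<phi>)
  then show ?case using assms(1) by (simp add: minterm_fm_decides_Box)
qed

section \<open>Characteristic minmatrices\<close>

abbreviation K_class :: "nat \<Rightarrow> nat \<Rightarrow> fm \<Rightarrow> fm set" where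
  "K_class v d \<phi> \<equiv> K_equiv v d `` {\<phi>}"

lemma K_class_self: "\<phi> \<in> Fm v d \<Longrightarrow> \<phi> \<in> K_class v d \<phi>"
  using normal_logic_tautology[OF normal_logic_K, of "Iff \<phi> \<phi>"]
  by (simp add: K_equiv_def tautology_def)

lemma alg_le_K_class_iff:
  assumes "\<phi> \<in> Fm v d" "\<psi> \<in> Fm v d"
  shows "alg_le (K_class v d \<phi>) (K_class v d \<psi>) \<longleftrightarrow> Imp \<phi> \<psi> \<in> K"
proof
  assume "alg_le (K_class v d \<phi>) (K_class v d \<psi>)"
  then obtain \<phi>' \<psi>' where "Iff \<phi> \<phi>' \<in> K" "Iff \<psi> \<psi>' \<in> K" "Imp \<phi>' \<psi>' \<in> K"
    by (auto simp: alg_le_def K_equiv_def)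
  then show "Imp \<phi> \<psi> \<in> K"
    by (intro normal_logic_taut_conseq[OF normal_logic_K, of "[Iff \<phi> \<phi>', Iff \<psi> \<psi>', Imp \<phi>' \<psi>']"])
      auto
next
  assume "Imp \<phi> \<psi> \<in> K"
  with K_class_self[OF assms(1)] K_class_self[OF assms(2)]
  show "alg_le (K_class v d \<phi>) (K_class v d \<psi>)"
    unfolding alg_le_def by blast
qed

lemma provable_K_class_iff:
  assumes S: "normal_logic S" and \<phi>: "\<phi> \<in> Fm v d"
  shows "provable S (K_class v d \<phi>) \<longleftrightarrow> \<phi> \<in> S"
proof
  assume "provable S (K_class v d \<phi>)"
  then obtain \<psi> where "Iff \<phi> \<psi> \<in> S" "\<psi> \<in> S"
    using K_subset_normal_logic[OF S] by (auto simp: provable_def K_equiv_def)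
  then show "\<phi> \<in> S"
    by (intro normal_logic_taut_conseq[OF S, of "[Iff \<phi> \<psi>, \<psi>]"]) auto
next
  show "\<phi> \<in> S \<Longrightarrow> provable S (K_class v d \<phi>)"
    using K_class_self[OF \<phi>] unfolding provable_def by blast
qed

lemma char_minmatrix_eq_INT:
  assumes "normal_logic S"
  shows "char_minmatrix v S = (\<Inter>\<phi>\<in>Fm v 1 \<inter> S. minset v (K_class v 1 \<phi>))"
proof -
  have "{minset v a | a. a \<in> K_alg v 1 \<and> provable S a} =
      (\<lambda>\<phi>. minset v (K_class v 1 \<phi>)) ` (Fm v 1 \<inter> S)"
    using provable_K_class_iff[OF assms, of _ v 1]
    by (auto simp: K_alg_def quotient_def image_iff)
  then show ?thesis
    unfolding char_minmatrix_def by simp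
qed

lemma char_minmatrix_subset_minterms:
  assumes "normal_logic S"
  shows "char_minmatrix v S \<subseteq> minterms v"
proof -
  have "Top \<in> Fm v 1 \<inter> S"
    using assms by (simp add: normal_logic_tautology tautology_def)
  then show ?thesis
    unfolding char_minmatrix_eq_INT[OF assms] minset_def by blast
qed

lemma minterm_in_char_minmatrix_iff:
  assumes "normal_logic S" "s < 2 ^ v" "holds R V w (minterm_fm v s \<epsilon>)"
  shows "minterm v s \<epsilon> \<in> char_minmatrix v S \<longleftrightarrow> (\<forall>\<phi>\<in>Fm v 1 \<inter> S. holds R V w \<phi>)"
proof -
  have "minterm v s \<epsilon> \<in> minset v (K_class v 1 \<phi>) \<longleftrightarrow> holds R V w \<phi>" if "\<phi> \<in> Fm v 1" for \<phi>
  proof -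
    have "minterm v s \<epsilon> \<in> minset v (K_class v 1 \<phi>) \<longleftrightarrow> alg_le (minterm v s \<epsilon>) (K_class v 1 \<phi>)"
      using assms(2) by (auto simp: minset_def minterms_def)
    also have "\<dots> \<longleftrightarrow> Imp (minterm_fm v s \<epsilon>) \<phi> \<in> K"
      unfolding minterm_def using minterm_fm_in_Fm that by (rule alg_le_K_class_iff)
    also have "\<dots> \<longleftrightarrow> holds R V w \<phi>"
      using minterm_fm_decides[OF assms(2) that] assms(3) by (rule K_decided_imp_iff_holds)
    finally show ?thesis .
  qed
  then show ?thesis
    by (auto simp: char_minmatrix_eq_INT[OF assms(1)])
qed

lemma char_minmatrix_closed_under_map:
  assumes S: "normal_logic S"
    and mem: "minterm v s' \<epsilon>' \<in> char_minmatrix v S"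
    and bounds: "s' < 2 ^ v" "s < 2 ^ v"
    and f: "f s' = s" "f ` successors v \<epsilon>' = successors v \<epsilon>"
  shows "minterm v s \<epsilon> \<in> char_minmatrix v S"
proof -
  obtain R V and w :: "nat option" where M: "holds R V w (minterm_fm v s' \<epsilon>')"
    using minterm_fm_satisfiable[OF bounds(1)] .
  define V' where "V' = (\<lambda>u k. holds R V u (map_subst v f k))"
  have V': "valuation_index v (V' u) = take_bit v (f (valuation_index v (V u)))" for u
    unfolding V'_def holds_map_subst by (rule valuation_index_bit)
  have root: "valuation_index v (V' w) = s"
    using M f(1) bounds by (simp add: V' holds_minterm_fm_iff take_bit_nat_eq_self)
  have "(\<lambda>u. valuation_index v (V' u)) ` {u. R w u} =
      take_bit v ` f ` (\<lambda>u. valuation_index v (V u)) ` {u. R w u}"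
    by (simp add: V' image_image)
  also have "\<dots> = successors v \<epsilon>"
    using M bounds(1) by (simp add: holds_minterm_fm_iff f(2) take_bit_image_successors)
  finally have M': "holds R V' w (minterm_fm v s \<epsilon>)"
    using root bounds(2) by (simp add: holds_minterm_fm_iff)
  have "holds R V' w \<phi>" if \<phi>: "\<phi> \<in> Fm v 1 \<inter> S" for \<phi>
  proof -
    have "subst (map_subst v f) \<phi> \<in> Fm v 1"
      using \<phi> subst_in_Fm[of \<phi> v 1 _ v 0] map_subst_in_Fm by simp
    moreover have "subst (map_subst v f) \<phi> \<in> S"
      using \<phi> S unfolding normal_logic_def by blast
    ultimately have "holds R V w (subst (map_subst v f) \<phi>)"
      using mem minterm_in_char_minmatrix_iff[OF S bounds(1) M] by blast
    then show ?thesis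
      unfolding holds_subst V'_def .
  qed
  then show ?thesis
    using minterm_in_char_minmatrix_iff[OF S bounds(2) M'] by blast
qed

section \<open>Classes of minterms\<close>

lemma ex_image_eq_mapping_point:
  assumes "finite A" "finite B" "card B \<le> card A" "A = {} \<longleftrightarrow> B = {}" "a \<in> A \<Longrightarrow> b \<in> B"
  obtains f where "f a = b" "f ` A = B"
proof -
  have "\<exists>g. g ` A = B"
  proof (cases "B = {}")
    case False
    have "\<exists>h. inj_on h B \<and> h ` B \<subseteq> A"
      using assms(1-3) by (simp add: inj_on_iff_card_le)
    with False show ?thesis by (simp add: inj_on_iff_surj)
  qed (use assms(4) in simp)
  then obtain g where g: "g ` A = B" ..
  show thesis
  proof (cases "a \<in> A")
    case True
    then obtain c where c: "c \<in> A" "g c = b"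
      using assms(5) g by blast
    show thesis
    proof (rule that[of "g \<circ> transpose a c"])
      show "(g \<circ> transpose a c) a = b" using c by simp
      have "transpose a c ` A = A"
        using True c(1) by simp
      then show "(g \<circ> transpose a c) ` A = B"
        using g by (simp only: image_comp [symmetric])
    qed
  next
    case False
    then have "(g(a := b)) ` A = g ` A" by (intro image_cong) auto
    then have "(g(a := b)) ` A = B" using g by simp
    then show thesis by (intro that[of "g(a := b)"]) simp_all
  qed
qed

definition minterm_class :: "nat \<Rightarrow> bool \<Rightarrow> nat \<Rightarrow> fm set set" where
  "minterm_class v r c = {minterm v s \<epsilon> | s \<epsilon>.
     s < 2 ^ v \<and> (s \<in> successors v \<epsilon> \<longleftrightarrow> r) \<and> card (successors v \<epsilon>) = c}"

lemma other_successors_eq: "{i. i < 2 ^ v \<and> i \<noteq> s \<and> \<epsilon> i} = successors v \<epsilon> - {s}"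
  by (auto simp: successors_def)

lemma Dw_eq_minterm_class: "Dw v k = minterm_class v True (Suc k)"
proof -
  have "s \<in> successors v \<epsilon> \<and> card (successors v \<epsilon>) = Suc k \<longleftrightarrow>
      \<epsilon> s \<and> card (successors v \<epsilon> - {s}) = k" if "s < 2 ^ v" for s \<epsilon>
    using card_Suc_Diff1[OF finite_successors[of v \<epsilon>], of s] that mem_successors_iff[OF that, of \<epsilon>]
    by auto
  then show ?thesis
    by (simp add: Dw_def minterm_class_def other_successors_eq cong: conj_cong)
qed

lemma Dc_eq_minterm_class: "Dc v k = minterm_class v False k"
proof -
  have "s \<notin> successors v \<epsilon> \<and> card (successors v \<epsilon>) = k \<longleftrightarrow>
      \<not> \<epsilon> s \<and> card (successors v \<epsilon> - {s}) = k" if "s < 2 ^ v" for s \<epsilon>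
    using that mem_successors_iff[OF that, of \<epsilon>] by auto
  then show ?thesis
    by (simp add: Dc_def minterm_class_def other_successors_eq cong: conj_cong)
qed

lemma Vv0_eq_minterm_class: "Vv0 v = minterm_class v False 0"
proof -
  have "(\<forall>i<2 ^ v. \<not> \<epsilon> i) \<longleftrightarrow> s \<notin> successors v \<epsilon> \<and> card (successors v \<epsilon>) = 0" for s \<epsilon>
    by (auto simp: successors_def)
  then show ?thesis
    unfolding Vv0_def minterm_class_def by simp
qed

lemma Dd0_eq_Dw_0: "Dd0 v = Dw v 0"
  by (auto simp: Dd0_def Dw_def)

lemma minterms_eq_UN_minterm_class: "minterms v = (\<Union>r c. minterm_class v r c)"
  unfolding minterms_def minterm_class_def by blast

lemma minterm_class_True_0: "minterm_class v True 0 = {}"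
  by (auto simp: minterm_class_def finite_successors)

lemma minterm_class_nonempty:
  assumes "if r then 0 < c \<and> c \<le> 2 ^ v else c < 2 ^ v"
  shows "minterm_class v r c \<noteq> {}"
proof -
  let ?s = "if r then 0 else c"
  have "successors v (\<lambda>i. i < c) = {..<c}"
    using assms by (auto simp: successors_def split: if_splits)
  moreover from this have "?s < 2 ^ v" "?s \<in> successors v (\<lambda>i. i < c) \<longleftrightarrow> r"
    using assms by simp_all
  ultimately have "minterm v ?s (\<lambda>i. i < c) \<in> minterm_class v r c"
    unfolding minterm_class_def by (intro CollectI exI[of _ ?s] exI[of _ "\<lambda>i. i < c"]) simp
  then show ?thesis by blast
qed

lemma minterm_class_subset_char_minmatrix:
  assumes S: "normal_logic S" and meets: "minterm_class v r' c' \<inter> char_minmatrix v S \<noteq> {}"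
    and weaker: "r' \<Longrightarrow> r" "c \<le> c'" "c = 0 \<longleftrightarrow> c' = 0"
  shows "minterm_class v r c \<subseteq> char_minmatrix v S"
proof
  fix m assume "m \<in> minterm_class v r c"
  then obtain s \<epsilon> where m: "m = minterm v s \<epsilon>"
    and s: "s < 2 ^ v" "s \<in> successors v \<epsilon> \<longleftrightarrow> r" "card (successors v \<epsilon>) = c"
    unfolding minterm_class_def by blast
  obtain s' \<epsilon>' where mem: "minterm v s' \<epsilon>' \<in> char_minmatrix v S"
    and s': "s' < 2 ^ v" "s' \<in> successors v \<epsilon>' \<longleftrightarrow> r'" "card (successors v \<epsilon>') = c'"
    using meets unfolding minterm_class_def by blast
  have "successors v \<epsilon>' = {} \<longleftrightarrow> successors v \<epsilon> = {}"
    using weaker(3) s(3) s'(3) by (metis card_0_eq finite_successors)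
  then obtain f where "f s' = s" "f ` successors v \<epsilon>' = successors v \<epsilon>"
    using ex_image_eq_mapping_point[of "successors v \<epsilon>'" "successors v \<epsilon>" s' s] s s' weaker(1,2)
    by (metis finite_successors)
  then show "m \<in> char_minmatrix v S"
    unfolding m by (rule char_minmatrix_closed_under_map[OF S mem s'(1) s(1)])
qed

lemma Vv0_or_Dd0_subset_char_minmatrix:
  assumes S: "normal_logic S" and "char_minmatrix v S \<noteq> {}"
  shows "Vv0 v \<subseteq> char_minmatrix v S \<or> Dd0 v \<subseteq> char_minmatrix v S"
proof -
  obtain r c where meets: "minterm_class v r c \<inter> char_minmatrix v S \<noteq> {}"
    using assms(2) char_minmatrix_subset_minterms[OF S, of v]
    unfolding minterms_eq_UN_minterm_class by blast
  note subset = minterm_class_subset_char_minmatrix[OF S meets]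
  show ?thesis
  proof (cases "c = 0")
    case True
    with meets have "\<not> r" using minterm_class_True_0 by auto
    with True have "Vv0 v \<subseteq> char_minmatrix v S"
      unfolding Vv0_eq_minterm_class by (intro subset) simp_all
    then show ?thesis ..
  next
    case False
    then have "Dd0 v \<subseteq> char_minmatrix v S"
      unfolding Dd0_eq_Dw_0 Dw_eq_minterm_class by (intro subset) simp_all
    then show ?thesis ..
  qed
qed

lemma Dw_subset_char_minmatrix_if_Dw_subset:
  assumes S: "normal_logic S" and Dw: "Dw v k \<subseteq> char_minmatrix v S" and "k < 2 ^ v" "l \<le> k"
  shows "Dw v l \<subseteq> char_minmatrix v S"
proof -
  have "minterm_class v True (Suc k) \<inter> char_minmatrix v S \<noteq> {}"
    using Dw minterm_class_nonempty[of True "Suc k" v] \<open>k < 2 ^ v\<close>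
    by (simp add: Dw_eq_minterm_class Int_absorb2)
  from minterm_class_subset_char_minmatrix[OF S this] show ?thesis
    using \<open>l \<le> k\<close> by (simp add: Dw_eq_minterm_class)
qed

lemma minterm_class_subset_char_minmatrix_if_Dc_subset:
  assumes S: "normal_logic S" and Dc: "Dc v k \<subseteq> char_minmatrix v S" and "k < 2 ^ v"
    and "1 \<le> c" "c \<le> k"
  shows "minterm_class v r c \<subseteq> char_minmatrix v S"
proof -
  have "minterm_class v False k \<inter> char_minmatrix v S \<noteq> {}"
    using Dc minterm_class_nonempty[of False k v] \<open>k < 2 ^ v\<close>
    by (simp add: Dc_eq_minterm_class Int_absorb2)
  from minterm_class_subset_char_minmatrix[OF S this] show ?thesis
    using \<open>1 \<le> c\<close> \<open>c \<le> k\<close> by simp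
qed

theorem theorem10:
  fixes v n :: nat and \<xi> :: "fm set set"
  assumes "v \<ge> 1"
    and "n = 2 ^ v"
    and "\<xi> \<in> char_minmatrices v"
    and "\<xi> \<noteq> {}"
  shows "(Vv0 v \<subseteq> \<xi> \<or> Dd0 v \<subseteq> \<xi>)
    \<and> (\<forall>k. 1 \<le> k \<and> k < n \<longrightarrow> Dw v k \<subseteq> \<xi> \<longrightarrow>
          Dd0 v \<subseteq> \<xi> \<and> (\<forall>l. 1 \<le> l \<and> l < k \<longrightarrow> Dw v l \<subseteq> \<xi>))
    \<and> (\<forall>k. 1 \<le> k \<and> k < n \<longrightarrow> Dc v k \<subseteq> \<xi> \<longrightarrow>
          Dd0 v \<subseteq> \<xi> \<and> (\<forall>l. 1 \<le> l \<and> l < k \<longrightarrow> Dw v l \<subseteq> \<xi>)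
                  \<and> (\<forall>l. 1 \<le> l \<and> l < k \<longrightarrow> Dc v l \<subseteq> \<xi>))"
proof -
  obtain S where S: "normal_logic S" and \<xi>: "\<xi> = char_minmatrix v S"
    using assms(3) by (auto simp: char_minmatrices_def)
  have DR1: "Vv0 v \<subseteq> \<xi> \<or> Dd0 v \<subseteq> \<xi>"
    using Vv0_or_Dd0_subset_char_minmatrix[OF S] assms(4) unfolding \<xi> .
  have DR2: "Dd0 v \<subseteq> \<xi> \<and> (\<forall>l. 1 \<le> l \<and> l < k \<longrightarrow> Dw v l \<subseteq> \<xi>)"
    if "1 \<le> k" "k < n" "Dw v k \<subseteq> \<xi>" for k
    using Dw_subset_char_minmatrix_if_Dw_subset[OF S, of v k] that
    unfolding \<xi> assms(2) Dd0_eq_Dw_0 by simp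
  have DR3: "Dd0 v \<subseteq> \<xi> \<and> (\<forall>l. 1 \<le> l \<and> l < k \<longrightarrow> Dw v l \<subseteq> \<xi>)
      \<and> (\<forall>l. 1 \<le> l \<and> l < k \<longrightarrow> Dc v l \<subseteq> \<xi>)"
    if "1 \<le> k" "k < n" "Dc v k \<subseteq> \<xi>" for k
    using minterm_class_subset_char_minmatrix_if_Dc_subset[OF S, of v k] that
    unfolding \<xi> assms(2) Dd0_eq_Dw_0 Dw_eq_minterm_class Dc_eq_minterm_class by simp
  show ?thesis
    using DR1 DR2 DR3 by meson
qed

end
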